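(* Let $k\ge4$ be even. For $0<\delta<1$ let $\mathcal F_\delta=\mathcal D\setminus\bigcup_{j=1}^3\{z\in\mathcal D:\ |z-e_j|\le\delta\}$ with $e_1=e^{\pi i/3}$, $e_2=i$, $e_3=e^{2\pi i/3}$. There exists an absolute constant $c_0>0$ such that, uniformly for all $0<\delta<1$, all $z=x+iy\in\mathcal F_\delta$ and all $w=u+iv\in\mathbb H^2$ with $|z-w|\le c_0\delta$, $$R_k(z,w)=2\Big(\frac{2i\sqrt{yv}}{z-\overline w}\Big)^k+O\Big(e^{-c_0\delta^2k}+y\,e^{-k/(17y^2)}\Big).$$
   Context: $\mathbb H^2=\{z=x+iy:\ y>0\}$, $\mathcal D=\{z\in\mathbb H^2:\ |\Re z|\le1/2,\ |z|\ge1\}$. For $\gamma=\begin{pmatrix}a&b\\c&d\end{pmatrix}\in\mathrm{SL}_2(\mathbb Z)$ acting by $\gamma z=\frac{az+b}{cz+d}$ and $z,w\in\mathbb H^2$, set $b_\gamma(z,w)=\frac{2i}{w+\gamma z}\cdot\frac{1}{cz+d}$. For $z=x+iy$, $w=u+iv\in\mathbb H^2$ and even $k\ge4$, define $$R_k(z,w)=(yv)^{k/2}\sum_{\gamma\in\mathrm{SL}_2(\mathbb Z)}b_\gamma(z,-\overline w)^k$$ (the normalized weight-$k$ Bergman kernel for cusp forms on $\mathrm{SL}_2(\mathbb Z)$). *)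

theory Defs
  imports "HOL-Analysis.Analysis"
begin

definition upper_half_plane :: "complex set" where
  "upper_half_plane = {z. Im z > 0}"

definition fund_domain :: "complex set" where
  "fund_domain = {z \<in> upper_half_plane. \<bar>Re z\<bar> \<le> 1/2 \<and> norm z \<ge> 1}"

definition SL2Z :: "(int^2^2) set" where
  "SL2Z = {\<gamma>. det \<gamma> = 1}"

definition aut_factor :: "int^2^2 \<Rightarrow> complex \<Rightarrow> complex" where
  "aut_factor \<gamma> z = of_int (\<gamma> $ 2 $ 1) * z + of_int (\<gamma> $ 2 $ 2)"

definition moebius_act :: "int^2^2 \<Rightarrow> complex \<Rightarrow> complex" where
  "moebius_act \<gamma> z = (of_int (\<gamma> $ 1 $ 1) * z + of_int (\<gamma> $ 1 $ 2)) / aut_factor \<gamma> z"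

definition bergman_b :: "int^2^2 \<Rightarrow> complex \<Rightarrow> complex \<Rightarrow> complex" where
  "bergman_b \<gamma> z w = 2 * \<i> / (w + moebius_act \<gamma> z) * (1 / aut_factor \<gamma> z)"

text \<open>The exponent \<open>k div 2\<close> is exact because the kernel is only used for even \<open>k\<close>. The sum is
  the unordered sum over the group; for \<open>k \<ge> 4\<close> the series converges absolutely.\<close>

definition R_kernel :: "nat \<Rightarrow> complex \<Rightarrow> complex \<Rightarrow> complex" where
  "R_kernel k z w = of_real ((Im z * Im w) ^ (k div 2)) *
     (\<Sum>\<^sub>\<infinity>\<gamma>\<in>SL2Z. bergman_b \<gamma> z (- cnj w) ^ k)"

definition F_region :: "real \<Rightarrow> complex set" where
  "F_region \<delta> = fund_domain -
     (\<Union>e\<in>{cis (pi / 3), \<i>, cis (2 * pi / 3)}. {z \<in> fund_domain. norm (z - e) \<le> \<delta>})"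

end

theory Submission
  imports Defs
begin

text \<open>
  For \<open>\<gamma> = (a, b; c, d)\<close> the \<open>\<gamma>\<close>-term of \<open>R\<^sub>k(z, w)\<close> has absolute value \<open>Q\<^bsup>-k/2\<^esup>\<close>, where
  \<open>Q = cosh\<^sup>2 (dist(\<gamma>z, w) / 2) = 1 + |\<gamma>z - w|\<^sup>2 / (4 Im(\<gamma>z) Im w)\<close>, and \<open>\<gamma> = \<plusminus>1\<close> give the main term.
  For the other translations \<open>Q \<ge> 1 + b\<^sup>2 / (6 y\<^sup>2)\<close>, and summing over \<open>b\<close> gives
  \<open>O(y exp(-k / (17 y\<^sup>2)))\<close>.
  If \<open>c \<noteq> 0\<close>, then \<open>Q\<close> can be close to \<open>1\<close> only for \<open>z\<close> close to an elliptic point, and quantitatively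
  \<open>Q \<ge> 1 + \<delta>\<^sup>2 / 10\<^sup>4\<close>. On the other hand \<open>Q\<close> dominates \<open>a\<^sup>2 + c\<^sup>2 + d\<^sup>2\<close> uniformly in \<open>z\<close>, and
  \<open>(a, c, d)\<close> determines \<open>\<gamma>\<close>, so that the sum of \<open>Q\<^sup>-\<^sup>2\<close> is bounded by a convergent sum over \<open>\<int>\<^sup>3\<close>.
  Writing \<open>Q\<^bsup>-k/2\<^esup> = Q\<^sup>-\<^sup>2 Q\<^bsup>2-k/2\<^esup>\<close> combines the two bounds.
\<close>

section \<open>Hyperbolic displacement and its identities\<close>

text \<open>This is \<open>cosh^2 (dist (\<gamma> z, w) / 2)\<close> with denominators cleared, by
  \<open>Im (\<gamma> z) * |c z + d|^2 = Im z\<close> for determinant 1. Four integers instead of a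
  matrix keep the estimates free of vector indexing.\<close>

definition displacement :: "int \<Rightarrow> int \<Rightarrow> int \<Rightarrow> int \<Rightarrow> complex \<Rightarrow> complex \<Rightarrow> real" where
  "displacement a b c d z w =
     (norm (of_int a * z + of_int b - cnj w * (of_int c * z + of_int d)))\<^sup>2 / (4 * Im z * Im w)"

text \<open>The cross terms combine to the determinant, which leaves a sum of squares.\<close>

lemma norm_twisted_difference_sq:
  fixes a b c d :: int
  assumes "a * d - b * c = 1"
  shows "(norm (of_int a * z + of_int b - cnj w * (of_int c * z + of_int d)))\<^sup>2 =
      (a * Re z + b - Re w * (c * Re z + d))\<^sup>2 + (Im w * c * Im z)\<^sup>2
      + (Im z * (a - Re w * c))\<^sup>2 + (Im w * (c * Re z + d))\<^sup>2 + 2 * Im z * Im w"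
proof -
  have "real_of_int (a * d - b * c) = 1" using assms by simp
  hence det: "real_of_int a * d = 1 + real_of_int b * c" by simp
  have "(norm (of_int a * z + of_int b - cnj w * (of_int c * z + of_int d)))\<^sup>2 =
      (a * Re z + b - Re w * (c * Re z + d))\<^sup>2 + (Im w * c * Im z)\<^sup>2
      + (Im z * (a - Re w * c))\<^sup>2 + (Im w * (c * Re z + d))\<^sup>2
      + 2 * Im z * Im w * (real_of_int a * d - real_of_int b * c)"
    by (simp add: cmod_power2) (simp add: power2_eq_square algebra_simps)
  thus ?thesis using det by simp
qed

text \<open>With \<open>p = \<gamma> z\<close>, this is
  \<open>|p - cnj w|^2 = |p - w|^2 + 4 Im p Im w\<close> after clearing denominators. It isolates
  the excess over 1 that the gap estimates bound from below.\<close>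

lemma displacement_eq:
  fixes a b c d :: int
  assumes "a * d - b * c = 1" "Im z > 0" "Im w > 0"
  shows "displacement a b c d z w = 1 +
    (norm (of_int a * z + of_int b - w * (of_int c * z + of_int d)))\<^sup>2 / (4 * Im z * Im w)"
proof -
  have "real_of_int (a * d - b * c) = 1" using assms by simp
  hence det: "real_of_int a * d = 1 + real_of_int b * c" by simp
  have "(norm (of_int a * z + of_int b - cnj w * (of_int c * z + of_int d)))\<^sup>2 =
      (norm (of_int a * z + of_int b - w * (of_int c * z + of_int d)))\<^sup>2
      + 4 * Im z * Im w * (real_of_int a * d - real_of_int b * c)"
    by (simp add: cmod_power2) (simp add: power2_eq_square algebra_simps)
  thus ?thesis using det assms by (simp add: displacement_def field_simps)
qed

section \<open>Uniform bounds over the fundamental domain\<close>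

lemma fund_domain_Im:
  assumes "z \<in> fund_domain"
  shows "Im z > 0" "(Im z)\<^sup>2 \<ge> 3/4" "Im z \<ge> sqrt 3 / 2" "Im z \<ge> 4/5"
proof -
  have x: "\<bar>Re z\<bar> \<le> 1/2" and n: "norm z \<ge> 1" and y: "Im z > 0"
    using assms by (auto simp: fund_domain_def upper_half_plane_def)
  have "(norm z)\<^sup>2 \<ge> 1" using n by simp
  moreover have "(Re z)\<^sup>2 \<le> (1/2)\<^sup>2" using x by (metis abs_ge_zero power2_abs power_mono)
  ultimately show y2: "(Im z)\<^sup>2 \<ge> 3/4" by (simp add: cmod_power2 power_divide)
  show "Im z > 0" by fact
  have "sqrt ((sqrt 3 / 2)\<^sup>2) \<le> sqrt ((Im z)\<^sup>2)"
    using y2 by (intro real_sqrt_le_mono) (simp add: power_divide)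
  thus "Im z \<ge> sqrt 3 / 2" using y by simp
  have "(4/5)\<^sup>2 \<le> (Im z)\<^sup>2" using y2 by (simp add: power_divide)
  thus "Im z \<ge> 4/5" using y by (rule power2_le_imp_le[OF _ less_imp_le])
qed

lemma near_fund_domain:
  assumes z: "z \<in> fund_domain" and zw: "norm (z - w) \<le> 1/4"
  shows "Im z > 0" "Im w > 0" "Im w \<ge> Im z / 2" "Im w \<le> 2 * Im z" "\<bar>Re w\<bar> \<le> 1"
proof -
  have "\<bar>Re z\<bar> \<le> 1/2" using z by (simp add: fund_domain_def)
  moreover have "\<bar>Re z - Re w\<bar> \<le> 1/4" "\<bar>Im z - Im w\<bar> \<le> 1/4"
    using abs_Re_le_cmod[of "z - w"] abs_Im_le_cmod[of "z - w"] zw by auto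
  \<comment> \<open>As \<open>Im z \<ge> 4/5\<close>, the shift 1/4 is less than
    \<open>Im z / 2\<close>, which gives both comparisons of heights.\<close>
  ultimately show "Im z > 0" "Im w > 0" "Im w \<ge> Im z / 2" "Im w \<le> 2 * Im z" "\<bar>Re w\<bar> \<le> 1"
    using fund_domain_Im(4)[OF z] by linarith+
qed

text \<open>Three of the squares in \<open>norm_twisted_difference_sq\<close> have weights at least
  a constant times \<open>Im z * Im w\<close>, the denominator of the displacement. They control
  \<open>c\<close>, \<open>a - c Re w\<close> and \<open>d + c Re z\<close>; since the real parts
  are bounded, \<open>a\<close> and \<open>d\<close> are recovered at the cost of multiples of
  \<open>c^2\<close>.\<close>

lemma displacement_ge_entries:
  fixes a b c d :: int
  assumes det: "a * d - b * c = 1" and z: "z \<in> fund_domain" and zw: "norm (z - w) \<le> 1/4"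
  shows "displacement a b c d z w \<ge> of_int (a\<^sup>2 + c\<^sup>2 + d\<^sup>2) / 128"
proof -
  let ?x = "Re z" and ?y = "Im z" and ?s = "Re w" and ?t = "Im w"
  have t: "?t \<ge> ?y / 2" "?t \<le> 2 * ?y" and s: "\<bar>?s\<bar> \<le> 1" and y0: "?y > 0" and t0: "?t > 0"
    using near_fund_domain[OF z zw] by auto
  have x: "\<bar>?x\<bar> \<le> 1/2" using z by (simp add: fund_domain_def)
  have y2: "?y\<^sup>2 \<ge> 3/4" by (rule fund_domain_Im(2)[OF z])
  have sq: "(p + q)\<^sup>2 \<ge> p\<^sup>2 / 2 - q\<^sup>2" for p q :: real
  proof -
    have "(p + q)\<^sup>2 - (p\<^sup>2 / 2 - q\<^sup>2) = (p + 2 * q)\<^sup>2 / 2"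
      by (simp add: power2_eq_square field_simps)
    thus ?thesis by (smt (verit) divide_nonneg_pos zero_le_power2)
  qed
  have ts: "\<bar>?s\<bar>\<^sup>2 \<le> 1" "\<bar>?x\<bar>\<^sup>2 \<le> 1"
    using s x by (auto simp: abs_square_le_1)
  have A: "(a - ?s * c)\<^sup>2 \<ge> (real_of_int a)\<^sup>2 / 2 - (real_of_int c)\<^sup>2"
    using sq[of a "- ?s * c"] mult_right_mono[OF ts(1), of "(real_of_int c)\<^sup>2"]
    by (simp add: power_mult_distrib)
  have D: "(c * ?x + d)\<^sup>2 \<ge> (real_of_int d)\<^sup>2 / 2 - (real_of_int c)\<^sup>2"
    using sq[of d "c * ?x"] mult_right_mono[OF ts(2), of "(real_of_int c)\<^sup>2"]
    by (simp add: power_mult_distrib algebra_simps)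
  have y2t: "?y\<^sup>2 \<ge> ?y * ?t / 2" and t2: "?t\<^sup>2 \<ge> ?y * ?t / 2" and yt: "?y * ?t \<ge> 3/8"
  proof -
    show "?y\<^sup>2 \<ge> ?y * ?t / 2" using mult_left_mono[OF t(2), of ?y] y0
      by (simp add: power2_eq_square)
    show "?t\<^sup>2 \<ge> ?y * ?t / 2" using mult_left_mono[OF t(1), of ?t] t0
      by (simp add: power2_eq_square mult.commute)
    have "?y * (?y / 2) \<le> ?y * ?t" using t(1) y0 by (intro mult_left_mono) auto
    moreover have "?y * (?y / 2) = ?y\<^sup>2 / 2" by (simp add: power2_eq_square)
    ultimately show "?y * ?t \<ge> 3/8" using y2 by linarith
  qed
  define Y where "Y = ?y * ?t"
  have Y: "Y > 0" "Y \<ge> 3/8" using yt Y_def by auto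
  define C where "C = (real_of_int c)\<^sup>2"
  define A' where "A' = (a - ?s * c)\<^sup>2"
  define D' where "D' = (c * ?x + d)\<^sup>2"
  have nn: "C \<ge> 0" "A' \<ge> 0" "D' \<ge> 0" by (auto simp: C_def A'_def D'_def)
  have "4 * Y * displacement a b c d z w =
      (norm (of_int a * z + of_int b - cnj w * (of_int c * z + of_int d)))\<^sup>2"
    using y0 t0 by (simp add: displacement_def Y_def)
  also have "\<dots> \<ge> (Y * Y) * C + ?y\<^sup>2 * A' + ?t\<^sup>2 * D'"
    unfolding norm_twisted_difference_sq[OF det] C_def A'_def D'_def Y_def
    using y0 t0 by (simp add: power_mult_distrib power2_eq_square mult_ac)
  finally have "(Y * Y) * C + ?y\<^sup>2 * A' + ?t\<^sup>2 * D' \<le> 4 * Y * displacement a b c d z w" .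
  moreover have "(Y * Y) * C \<ge> Y * (3/8) * C" using Y nn by (intro mult_right_mono mult_left_mono) auto
  moreover have "?y\<^sup>2 * A' \<ge> (Y/2) * A'" using y2t nn by (intro mult_right_mono) (auto simp: Y_def)
  moreover have "?t\<^sup>2 * D' \<ge> (Y/2) * D'" using t2 nn by (intro mult_right_mono) (auto simp: Y_def)
  ultimately have "Y * (3/8 * C + A'/2 + D'/2) \<le> Y * (4 * displacement a b c d z w)"
    by (simp add: algebra_simps)
  hence "3/8 * C + A'/2 + D'/2 \<le> 4 * displacement a b c d z w" using Y by simp
  \<comment> \<open>Weakening 1/2 to 1/16 keeps the total loss at \<open>C / 8\<close>, which the
    available \<open>3/8 * C\<close> absorbs.\<close>
  moreover have "A' / 2 \<ge> ((real_of_int a)\<^sup>2 / 2 - C) / 16" "D' / 2 \<ge> ((real_of_int d)\<^sup>2 / 2 - C) / 16"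
  proof -
    have "X / 16 \<le> Z / 2" if "X \<le> Z" "0 \<le> Z" for X Z :: real
      using that by linarith
    thus "A' / 2 \<ge> ((real_of_int a)\<^sup>2 / 2 - C) / 16" "D' / 2 \<ge> ((real_of_int d)\<^sup>2 / 2 - C) / 16"
      using A D nn unfolding A'_def[symmetric] D'_def[symmetric] C_def[symmetric] by blast+
  qed
  ultimately have "4 * displacement a b c d z w \<ge> ((real_of_int a)\<^sup>2 + C + (real_of_int d)\<^sup>2) / 32"
    using nn(1) by (simp add: field_simps)
  thus ?thesis by (simp add: C_def)
qed

section \<open>Elliptic points and the gap above 1\<close>

text \<open>
  Conjugating by the matrix that maps \<open>\<i>\<close> to \<open>z\<close> turns \<open>(a, b; c, d)\<close> into \<open>(A, P/y; cy, D)\<close>. The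
  hypothesis says that this is nearly a rotation, so \<open>A\<^sup>2 + c\<^sup>2y\<^sup>2\<close> is nearly \<open>1\<close>, which leaves finitely
  many \<open>(a, c, d)\<close>.
\<close>

lemma near_elliptic_point:
  fixes a b c d :: int
  assumes z: "z \<in> fund_domain" and det: "a * d - b * c = 1" and c: "c > 0"
    and e: "e \<le> 1/10" "norm (of_int a * z + of_int b - z * (of_int c * z + of_int d)) \<le> e * Im z"
  shows "\<exists>p\<in>{cis (pi / 3), \<i>, cis (2 * pi / 3)}. norm (z - p) \<le> 4 * e"
proof -
  define x y where "x = Re z" and "y = Im z"
  define L where "L = of_int a * z + of_int b - z * (of_int c * z + of_int d)"
  define A D P where "A = a - c * x" and "D = c * x + d" and "P = b + (a - d) * x - c * x\<^sup>2"
  have x: "\<bar>x\<bar> \<le> 1/2" and zn: "norm z \<ge> 1" using z by (auto simp: fund_domain_def x_def)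
  have y: "y > 0" "y\<^sup>2 \<ge> 3/4" "y \<ge> sqrt 3 / 2" "y \<ge> 4/5"
    using fund_domain_Im[OF z] by (auto simp: y_def)
  have "1\<^sup>2 \<le> (norm z)\<^sup>2" using zn by (intro power_mono) auto
  hence n1: "x\<^sup>2 + y\<^sup>2 \<ge> 1" by (simp add: cmod_power2 x_def y_def)
  have Im: "Im L = y * (A - D)" and Re: "Re L = P + c * y\<^sup>2"
    by (simp_all add: L_def A_def D_def P_def x_def y_def power2_eq_square algebra_simps)
  have "real_of_int (a * d - b * c) = 1" using det by simp
  hence det': "A * D - c * P = 1"
    by (simp add: A_def D_def P_def power2_eq_square algebra_simps)
  have L: "norm L \<le> e * y" using e(2) by (simp add: L_def y_def)
  have "0 \<le> e * y" using L norm_ge_zero[of L] by linarith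
  hence e0: "e \<ge> 0" using y(1) by (simp add: zero_le_mult_iff)
  have "\<bar>y * (A - D)\<bar> \<le> e * y" using abs_Im_le_cmod[of L] L Im by simp
  hence AD: "\<bar>A - D\<bar> \<le> e" using y by (simp add: abs_mult)
  have PC: "\<bar>P + c * y\<^sup>2\<bar> \<le> e * y" using abs_Re_le_cmod[of L] L Re by simp
  define h where "h = c * y"
  have h: "h > 0" using c y by (simp add: h_def)
  \<comment> \<open>The factor \<open>c\<close> brings in the determinant through
    \<open>c * P = A * D - 1\<close>. Trading \<open>D\<close> for \<open>A\<close> afterwards costs
    at most \<open>e * |A|\<close>.\<close>
  have "c * (P + c * y\<^sup>2) \<le> c * (e * y)" using PC c by (intro mult_left_mono) auto
  hence 1: "A * D + h\<^sup>2 \<le> 1 + e * h"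
    using det' by (simp add: h_def algebra_simps power2_eq_square)
  have "A * (A - D) \<le> \<bar>A\<bar> * \<bar>A - D\<bar>" by (simp flip: abs_mult)
  also have "\<dots> \<le> \<bar>A\<bar> * e" using AD by (intro mult_left_mono) auto
  finally have 2: "A\<^sup>2 - e * \<bar>A\<bar> + h\<^sup>2 \<le> 1 + e * h"
    using 1 by (simp add: algebra_simps power2_eq_square)
  have eA: "e * \<bar>A\<bar> \<le> \<bar>A\<bar> / 10" and eh: "e * h \<le> h / 10"
    using e(1) h mult_right_mono[of e "1/10" "\<bar>A\<bar>"] mult_right_mono[of e "1/10" h] by auto
  have "(\<bar>A\<bar> - 1/20)\<^sup>2 \<ge> 0" by simp
  hence A2: "A\<^sup>2 - \<bar>A\<bar> / 10 \<ge> - 1/400" by (simp add: power2_eq_square algebra_simps)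
  \<comment> \<open>If \<open>h \<ge> 11/10\<close>, then
    \<open>h^2 - h/10 \<ge> h \<ge> 11/10\<close>, above the permitted
    \<open>1 + 1/400\<close>.\<close>
  have h11: "h < 11/10"
  proof (rule ccontr)
    assume "\<not> h < 11/10"
    hence "h * h \<ge> 11/10 * h" by (intro mult_right_mono) auto
    hence "h\<^sup>2 \<ge> 11/10 * h" by (simp add: power2_eq_square)
    thus False using 2 A2 eA eh \<open>\<not> h < 11/10\<close> by linarith
  qed
  have c1: "c = 1"
  proof (rule ccontr)
    assume "c \<noteq> 1"
    hence "real_of_int c \<ge> 2" using c by linarith
    hence "h \<ge> 2 * y" using y by (simp add: h_def)
    thus False using h11 y by simp
  qed
  have hy: "h = y" by (simp add: h_def c1)
  \<comment> \<open>Otherwise \<open>A^2 - e * |A| \<ge> 0.42\<close> and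
    \<open>y^2 - e * y \<ge> 0.75 - 0.11\<close>, with sum greater than 1.\<close>
  have A07: "\<bar>A\<bar> < 7/10"
  proof (rule ccontr)
    assume A: "\<not> \<bar>A\<bar> < 7/10"
    hence "\<bar>A\<bar> * \<bar>A\<bar> \<ge> 7/10 * \<bar>A\<bar>" by (intro mult_right_mono) auto
    hence "A\<^sup>2 \<ge> 7/10 * \<bar>A\<bar>" by (simp add: power2_eq_square)
    thus False using 2 eA eh A h11 y(2) unfolding hy by linarith
  qed
  have "e * \<bar>A\<bar> \<le> e * (7/10)" "e * h \<le> e * (11/10)"
    by (intro mult_left_mono; use e0 A07 h11 in linarith)+
  hence main: "A\<^sup>2 + y\<^sup>2 \<le> 1 + 2 * e" using 2 hy e0 by simp
  have a1: "\<bar>a\<bar> \<le> 1" and d1: "\<bar>d\<bar> \<le> 1"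
  proof -
    have "\<bar>p\<bar> < 2 \<and> \<bar>q\<bar> < 2" if "\<bar>p - x\<bar> < 7/10" "\<bar>p - x - (x + q)\<bar> \<le> e" for p q :: real
      using that x e(1) by (auto simp: abs_if split: if_splits)
    hence "\<bar>real_of_int a\<bar> < 2 \<and> \<bar>real_of_int d\<bar> < 2"
      using A07 AD unfolding A_def D_def c1 of_int_1 mult_1 by blast
    thus "\<bar>a\<bar> \<le> 1" "\<bar>d\<bar> \<le> 1" by linarith+
  qed
  \<comment> \<open>The budget \<open>4 * e\<close> is \<open>e\<close> horizontally plus
    \<open>3 * e\<close> vertically; the latter comes from factoring \<open>y^2 - 3/4\<close>, whose
    larger factor is at least 1.\<close>
  have corner: "norm (z - p) \<le> 4 * e"
    if "\<bar>Re z - Re p\<bar> \<le> e" "Im p = sqrt 3 / 2" "y\<^sup>2 \<le> 3/4 + 3 * e" for p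
  proof -
    have "sqrt 3 > 1" by simp
    hence "(y - sqrt 3 / 2) * 1 \<le> (y - sqrt 3 / 2) * (y + sqrt 3 / 2)"
      using y(3,4) by (intro mult_left_mono) linarith+
    also have "\<dots> = y\<^sup>2 - 3/4" by (simp add: power2_eq_square algebra_simps)
    finally have "\<bar>y - sqrt 3 / 2\<bar> \<le> 3 * e" using that(3) y by simp
    thus ?thesis using cmod_le[of "z - p"] that(1,2) by (simp add: y_def)
  qed
  have right: ?thesis if "x \<ge> 1/2 - e" "y\<^sup>2 \<le> 3/4 + 3 * e"
  proof -
    have "norm (z - cis (pi/3)) \<le> 4 * e"
      using that x by (intro corner) (auto simp: cos_60 sin_60 x_def)
    thus ?thesis by blast
  qed
  have left: ?thesis if "x \<le> -1/2 + e" "y\<^sup>2 \<le> 3/4 + 3 * e"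
  proof -
    have "norm (z - cis (2*pi/3)) \<le> 4 * e"
      using that x by (intro corner) (auto simp: cos_120 sin_120 x_def)
    thus ?thesis by blast
  qed
  have sqr: "x\<^sup>2 \<ge> 1/4 - e" if "\<bar>x\<bar> \<ge> 1/2 - e"
  proof -
    have "(\<bar>x\<bar> - 1/2)\<^sup>2 \<ge> 0" by simp
    thus ?thesis using that by (simp add: power2_eq_square algebra_simps)
  qed
  \<comment> \<open>With \<open>c = 1\<close>, the case \<open>a = d = 0\<close> is the inversion
    about \<open>\<i>\<close>. Each other case forces \<open>x\<close> to within \<open>e\<close> of
    1/2 or -1/2, hence \<open>z\<close> towards a corner.\<close>
  consider "a = 0" "d = 0" | "a = 0" "d = -1" | "a = 0" "d = 1" | "a = 1" | "a = -1"
    using a1 d1 by linarith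
  thus ?thesis
  proof cases
    case 1
    hence xe: "\<bar>x\<bar> \<le> e / 2" using AD by (simp add: A_def D_def c1)
    have m: "x\<^sup>2 + y\<^sup>2 \<le> 1 + 2 * e" using main 1 by (simp add: A_def c1)
    have "\<bar>x\<bar> * \<bar>x\<bar> \<le> e * 1" using xe e(1) e0 by (intro mult_mono) auto
    hence x2: "x\<^sup>2 \<le> e" by (simp add: power2_eq_square)
    have "\<bar>y - 1\<bar> * 1 \<le> \<bar>y - 1\<bar> * (y + 1)" using y by (intro mult_left_mono) auto
    also have "\<dots> = \<bar>(y - 1) * (y + 1)\<bar>" using y(1) by (simp add: abs_mult)
    also have "(y - 1) * (y + 1) = y\<^sup>2 - 1" by (simp add: power2_eq_square algebra_simps)
    also have "\<bar>y\<^sup>2 - 1\<bar> \<le> 2 * e" using m n1 x2 e0 zero_le_power2[of x] by linarith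
    finally have "\<bar>y - 1\<bar> \<le> 2 * e" by simp
    hence "norm (z - \<i>) \<le> 4 * e" using cmod_le[of "z - \<i>"] xe e0 by (simp add: x_def y_def)
    thus ?thesis by blast
  next
    case 2
    hence "x \<ge> 1/2 - e" using AD e0 by (simp add: A_def D_def c1)
    moreover have "x\<^sup>2 + y\<^sup>2 \<le> 1 + 2 * e" using main 2 by (simp add: A_def c1)
    ultimately show ?thesis using sqr by (intro right) linarith+
  next
    case 3
    hence "x \<le> -1/2 + e" using AD e0 by (simp add: A_def D_def c1)
    moreover have "x\<^sup>2 + y\<^sup>2 \<le> 1 + 2 * e" using main 3 by (simp add: A_def c1)
    ultimately show ?thesis using sqr by (intro left) linarith+
  next
    case 4
    hence m: "(1 - x)\<^sup>2 + y\<^sup>2 \<le> 1 + 2 * e" using main by (simp add: A_def c1)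
    hence xe: "x \<ge> 1/2 - e" using n1 by (simp add: power2_eq_square algebra_simps)
    moreover have "(1 - x)\<^sup>2 \<ge> 1/4" using power_mono[of "1/2" "1 - x" 2] x by (simp add: power_divide)
    ultimately show ?thesis using m e0 by (intro right) linarith+
  next
    case 5
    hence m: "(1 + x)\<^sup>2 + y\<^sup>2 \<le> 1 + 2 * e" using main by (simp add: A_def c1 power2_eq_square algebra_simps)
    hence xe: "x \<le> -1/2 + e" using n1 by (simp add: power2_eq_square algebra_simps)
    moreover have "(1 + x)\<^sup>2 \<ge> 1/4" using power_mono[of "1/2" "1 + x" 2] x by (simp add: power_divide)
    ultimately show ?thesis using m e0 by (intro left) linarith+
  qed
qed

text \<open>Negating all entries preserves the norm, so \<open>c > 0\<close> may be assumed. Then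
  \<open>near_elliptic_point\<close> with \<open>e = \<delta> / 10\<close> would put
  \<open>z\<close> inside one of the removed discs.\<close>

lemma elliptic_gap:
  fixes a b c d :: int
  assumes z: "z \<in> F_region \<delta>" and \<delta>: "0 < \<delta>" "\<delta> < 1"
    and det: "a * d - b * c = 1" and c: "c \<noteq> 0"
  shows "norm (of_int a * z + of_int b - z * (of_int c * z + of_int d)) > \<delta> / 10 * Im z"
proof (rule ccontr)
  let ?L = "\<lambda>a b c d :: int. of_int a * z + of_int b - z * (of_int c * z + of_int d)"
  assume "\<not> ?thesis"
  hence L: "norm (?L a b c d) \<le> \<delta> / 10 * Im z" by simp
  have zD: "z \<in> fund_domain" using z by (simp add: F_region_def)
  have "\<exists>p\<in>{cis (pi / 3), \<i>, cis (2 * pi / 3)}. norm (z - p) \<le> 4 * (\<delta> / 10)"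
  proof (cases "c > 0")
    case True
    show ?thesis using near_elliptic_point[OF zD det True _ L] \<delta> by simp
  next
    case False
    have "?L (-a) (-b) (-c) (-d) = - ?L a b c d" by (simp add: algebra_simps)
    hence L': "norm (?L (-a) (-b) (-c) (-d)) \<le> \<delta> / 10 * Im z" using L by (metis norm_minus_cancel)
    show ?thesis using near_elliptic_point[OF zD _ _ _ L'] det c False \<delta> by simp
  qed
  then obtain p where p: "p \<in> {cis (pi / 3), \<i>, cis (2 * pi / 3)}" "norm (z - p) \<le> 4 * (\<delta> / 10)"
    by blast
  hence "norm (z - p) \<le> \<delta>" using \<delta> by simp
  thus False using z zD p(1) by (auto simp: F_region_def)
qed

text \<open>A smaller displacement would make \<open>az + b - w(cz + d)\<close> small. Replacing
  \<open>w\<close> by \<open>z\<close> costs \<open>|z - w| |cz + d|\<close>, and the displacement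
  itself bounds \<open>|cz + d|\<close>, so \<open>elliptic_gap\<close> would be violated.\<close>

lemma displacement_gap:
  fixes a b c d :: int
  assumes z: "z \<in> F_region \<delta>" and \<delta>: "0 < \<delta>" "\<delta> < 1"
    and det: "a * d - b * c = 1" and c: "c \<noteq> 0" and zw: "norm (z - w) \<le> \<delta> / 100000"
  shows "displacement a b c d z w \<ge> 1 + \<delta>\<^sup>2 / 10000"
proof (rule ccontr)
  assume *: "\<not> ?thesis"
  let ?Lw = "of_int a * z + of_int b - w * (of_int c * z + of_int d)"
  let ?L = "of_int a * z + of_int b - z * (of_int c * z + of_int d)"
  let ?j = "of_int c * z + of_int d"
  define y t where "y = Im z" and "t = Im w"
  have zD: "z \<in> fund_domain" using z by (simp add: F_region_def)
  have "norm (z - w) \<le> 1/4" using zw \<delta> by linarith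
  note nf = near_fund_domain[OF zD this]
  have yt: "y > 0" "t > 0" "t \<ge> y / 2" "t \<le> 2 * y" "y \<ge> 4/5"
    using nf fund_domain_Im(4)[OF zD] by (auto simp: y_def t_def)
  have "\<delta>\<^sup>2 \<le> 1" using \<delta> by (simp add: power_le_one)
  hence Q2: "displacement a b c d z w \<le> 2" using * by simp
  have "(norm ?Lw)\<^sup>2 / (4 * y * t) \<le> \<delta>\<^sup>2 / 10000"
    using * displacement_eq[OF det nf(1,2)] by (simp add: y_def t_def)
  hence "(norm ?Lw)\<^sup>2 \<le> \<delta>\<^sup>2 / 10000 * (4 * y * t)" using yt by (simp add: field_simps)
  also have "\<dots> \<le> \<delta>\<^sup>2 / 10000 * (4 * y * (2 * y))"
    using yt by (intro mult_left_mono) auto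
  \<comment> \<open>The factor 8 is rounded up to 9 to obtain a perfect square.\<close>
  also have "\<dots> \<le> (3 * y * \<delta> / 100)\<^sup>2"
    using \<delta> yt by (simp add: power_mult_distrib power_divide power2_eq_square)
  finally have Lw: "norm ?Lw \<le> 3 * y * \<delta> / 100"
    using yt \<delta> by (intro power2_le_imp_le[of "norm ?Lw"]) auto
  \<comment> \<open>The two squares in \<open>norm_twisted_difference_sq\<close> with the factor
    \<open>Im w\<close> add up to \<open>t^2 |cz + d|^2\<close>.\<close>
  have "t\<^sup>2 * (norm ?j)\<^sup>2 = (t * c * y)\<^sup>2 + (t * (c * Re z + d))\<^sup>2"
    unfolding cmod_power2 by (simp add: y_def power2_eq_square algebra_simps)
  also have "\<dots> \<le> (norm (of_int a * z + of_int b - cnj w * ?j))\<^sup>2"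
    unfolding norm_twisted_difference_sq[OF det] using yt by (simp add: y_def t_def)
  also have "\<dots> = 4 * y * t * displacement a b c d z w"
    using yt by (simp add: displacement_def y_def t_def)
  also have "\<dots> \<le> 4 * y * t * 2" using yt Q2 by (intro mult_left_mono) auto
  also have "\<dots> \<le> 4 * (2 * t) * t * 2" using yt by (intro mult_right_mono mult_left_mono) auto
  finally have "t\<^sup>2 * (norm ?j)\<^sup>2 \<le> t\<^sup>2 * 4\<^sup>2" by (simp add: power2_eq_square)
  hence "(norm ?j)\<^sup>2 \<le> 4\<^sup>2" using yt by simp
  hence j: "norm ?j \<le> 4" by (rule power2_le_imp_le) simp
  have "?L = ?Lw - (z - w) * ?j" by (simp add: algebra_simps)
  hence "norm ?L \<le> norm ?Lw + norm (z - w) * norm ?j" by (metis norm_mult norm_triangle_ineq4)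
  also have "\<dots> \<le> 3 * y * \<delta> / 100 + (\<delta> / 100000) * 4"
    using Lw zw j \<delta> by (intro add_mono mult_mono) auto
  \<comment> \<open>Here \<open>4 \<le> 5 * y\<close> makes the second error proportional to
    \<open>y\<close> as well.\<close>
  also have "\<dots> \<le> 3 * y * \<delta> / 100 + \<delta> / 100000 * (5 * y)"
    using yt \<delta> by (intro add_mono mult_left_mono) auto
  also have "\<dots> \<le> \<delta> / 10 * y" using yt \<delta> by (simp add: field_simps)
  finally show False using elliptic_gap[OF z \<delta> det c] by (simp add: y_def)
qed

text \<open>Here \<open>a = d\<close> is a sign, so the relevant norm is that of \<open>b\<close>
  plus a vector of length at most 1/100. The constant 6 leaves room for this loss and for replacing
  \<open>Im w\<close> by \<open>Im z\<close>.\<close>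

lemma displacement_translation:
  fixes a b d :: int
  assumes z: "z \<in> fund_domain" and ad: "a * d = 1" and zw: "norm (z - w) \<le> 1/100"
  shows "displacement a b 0 d z w \<ge> 1 + (real_of_int b)\<^sup>2 / (6 * (Im z)\<^sup>2)"
proof -
  define y t where "y = Im z" and "t = Im w"
  have "norm (z - w) \<le> 1/4" using zw by simp
  note nf = near_fund_domain[OF z this]
  have "\<bar>y - t\<bar> \<le> 1/100" using abs_Im_le_cmod[of "z - w"] zw by (simp add: y_def t_def)
  \<comment> \<open>The factor 81/80 arises from
    \<open>1/100 = (4/5) / 80 \<le> y / 80\<close>.\<close>
  hence yt: "y > 0" "t > 0" "t \<le> 81/80 * y"
    using nf(1,2) fund_domain_Im(4)[OF z] unfolding y_def t_def by linarith+
  have "a = d" "\<bar>a\<bar> = 1" using ad by (auto simp: zmult_eq_1_iff)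
  have eq: "of_int a * z + of_int b - w * of_int d = of_int a * (z - w) + of_int b"
    using \<open>a = d\<close> by (simp add: algebra_simps)
  have na: "norm (of_int a * (z - w)) = norm (z - w)"
    using \<open>\<bar>a\<bar> = 1\<close> by (simp add: norm_mult flip: of_int_abs)
  have "99/100 * \<bar>real_of_int b\<bar> \<le> norm (of_int a * (z - w) + of_int b)"
  proof (cases "b = 0")
    case False
    hence "\<bar>real_of_int b\<bar> \<ge> 1" by linarith
    moreover have "norm (of_int b :: complex) - norm (of_int a * (z - w)) \<le> norm (of_int b + of_int a * (z - w))"
      by (rule norm_diff_ineq)
    ultimately show ?thesis using na zw by (simp add: add.commute)
  qed simp
  hence "(99/100 * \<bar>real_of_int b\<bar>)\<^sup>2 \<le> (norm (of_int a * (z - w) + of_int b))\<^sup>2"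
    by (intro power_mono) auto
  hence "(99/100)\<^sup>2 * (real_of_int b)\<^sup>2 / (4 * y * t) \<le> (norm (of_int a * (z - w) + of_int b))\<^sup>2 / (4 * y * t)"
    using yt unfolding power_mult_distrib power2_abs by (intro divide_right_mono) auto
  moreover have "(real_of_int b)\<^sup>2 / (6 * y\<^sup>2) \<le> (99/100)\<^sup>2 * (real_of_int b)\<^sup>2 / (4 * y * t)"
  proof -
    have "4 * y * t \<le> 4 * y * (81/80 * y)" using yt by (intro mult_left_mono) auto
    also have "\<dots> \<le> (99/100)\<^sup>2 * (6 * y\<^sup>2)" by (simp add: power2_eq_square)
    finally have "(real_of_int b)\<^sup>2 * (4 * y * t) \<le> (real_of_int b)\<^sup>2 * ((99/100)\<^sup>2 * (6 * y\<^sup>2))"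
      by (intro mult_left_mono) auto
    thus ?thesis using yt by (simp add: divide_simps mult_ac)
  qed
  moreover have "displacement a b 0 d z w = 1 + (norm (of_int a * (z - w) + of_int b))\<^sup>2 / (4 * y * t)"
    using displacement_eq[of a d b 0 z w] ad nf eq by (simp add: y_def t_def)
  ultimately show ?thesis by (simp add: y_def)
qed

section \<open>Sums over the integers\<close>

text \<open>The absolute value is injective on the nonnegative and on the negative integers
  separately, and each half contributes at most \<open>B\<close>.\<close>

lemma sum_abs_int_le:
  fixes g :: "nat \<Rightarrow> real"
  assumes g: "\<And>n. g n \<ge> 0" and B: "\<And>N. (\<Sum>n<N. g n) \<le> B" and F: "finite F"
  shows "(\<Sum>n\<in>F. g (nat \<bar>n\<bar>)) \<le> 2 * B"
proof -
  have *: "(\<Sum>n\<in>G. g (nat \<bar>n\<bar>)) \<le> B" if G: "finite G" and inj: "inj_on (\<lambda>n. nat \<bar>n\<bar>) G" for G :: "int set"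
  proof -
    obtain N where N: "(\<lambda>n. nat \<bar>n\<bar>) ` G \<subseteq> {..<N}"
      using finite_nat_iff_bounded finite_imageI[OF G] by metis
    have "(\<Sum>n\<in>G. g (nat \<bar>n\<bar>)) = sum g ((\<lambda>n. nat \<bar>n\<bar>) ` G)"
      by (simp add: sum.reindex[OF inj])
    also have "\<dots> \<le> (\<Sum>n<N. g n)" using N g by (intro sum_mono2) auto
    finally show ?thesis using B[of N] by simp
  qed
  have "(\<Sum>n\<in>F. g (nat \<bar>n\<bar>)) =
      (\<Sum>n\<in>F \<inter> {0..}. g (nat \<bar>n\<bar>)) + (\<Sum>n\<in>F - {0..}. g (nat \<bar>n\<bar>))"
    by (rule sum.Int_Diff[OF F])
  also have "\<dots> \<le> B + B" using F by (intro add_mono *) (auto simp: inj_on_def)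
  finally show ?thesis by simp
qed

text \<open>The terms are dominated by differences of \<open>2 * Y^2 / (Y + n)\<close>, so the sum
  telescopes. The linear growth in \<open>Y\<close> is the source of the factor \<open>y\<close> in
  the error term.\<close>

lemma sum_inverse_squares_scaled_le:
  fixes Y :: real
  assumes Y: "Y > 0"
  shows "(\<Sum>n<N. (1 / (1 + (real n / Y)\<^sup>2))\<^sup>2) \<le> 1 + 2 * Y"
proof -
  have step: "(1 / (1 + (real (Suc n) / Y)\<^sup>2))\<^sup>2 \<le> 2 * Y\<^sup>2 / (Y + n) - 2 * Y\<^sup>2 / (Y + Suc n)" for n
  proof -
    define r where "r = real (Suc n) / Y"
    have r: "r > 0" using Y by (simp add: r_def)
    have "(1 / (1 + r\<^sup>2))\<^sup>2 \<le> 1 / (1 + r\<^sup>2)"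
      using power_decreasing[of 1 2 "1 / (1 + r\<^sup>2)"] r by (simp add: add_pos_pos)
    also have "\<dots> \<le> 2 / (1 + r)\<^sup>2"
    proof -
      have "(1 - r)\<^sup>2 \<ge> 0" by simp
      hence "(1 + r)\<^sup>2 \<le> 2 * (1 + r\<^sup>2)" by (simp add: power2_eq_square algebra_simps)
      thus ?thesis using r by (simp add: divide_simps add_pos_nonneg)
    qed
    also have "\<dots> = 2 * Y\<^sup>2 / (Y + Suc n)\<^sup>2"
    proof -
      have "1 + r = (Y + Suc n) / Y" using Y by (simp add: r_def field_simps)
      thus ?thesis by (simp add: power_divide)
    qed
    also have "\<dots> \<le> 2 * Y\<^sup>2 / ((Y + n) * (Y + Suc n))"
      using Y by (intro divide_left_mono) (auto simp: power2_eq_square intro!: mult_pos_pos)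
    also have "\<dots> = 2 * Y\<^sup>2 / (Y + n) - 2 * Y\<^sup>2 / (Y + Suc n)"
    proof -
      define p where "p = Y + real n"
      have p: "p > 0" "Y + real (Suc n) = p + 1" using Y by (auto simp: p_def)
      show ?thesis unfolding p(2) p_def[symmetric] using p(1) by (simp add: field_simps)
    qed
    finally show ?thesis by (simp add: r_def)
  qed
  \<comment> \<open>Summing to \<open>Suc N\<close> keeps the term \<open>n = 0\<close>, equal to 1,
    outside the telescoping and makes the base case an equality.\<close>
  have *: "(\<Sum>n<Suc N. (1 / (1 + (real n / Y)\<^sup>2))\<^sup>2) \<le> 1 + 2 * Y - 2 * Y\<^sup>2 / (Y + N)" for N
  proof (induction N)
    case 0
    show ?case using Y by (simp add: power2_eq_square)
  next
    case (Suc N)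
    show ?case using Suc step[of N] by (subst sum.lessThan_Suc) linarith
  qed
  have "(\<Sum>n<N. (1 / (1 + (real n / Y)\<^sup>2))\<^sup>2) \<le> (\<Sum>n<Suc N. (1 / (1 + (real n / Y)\<^sup>2))\<^sup>2)"
    by simp
  also have "\<dots> \<le> 1 + 2 * Y - 2 * Y\<^sup>2 / (Y + N)" by (rule *)
  also have "\<dots> \<le> 1 + 2 * Y" using Y by simp
  finally show ?thesis .
qed

text \<open>The exponent \<open>4/3\<close> exceeds \<open>1\<close>, so the right hand side is summable over \<open>\<int>\<^sup>3\<close>.\<close>

lemma inverse_norm_le_product:
  fixes a c d :: int
  assumes "c \<noteq> 0"
  shows "(1 / of_int (a\<^sup>2 + c\<^sup>2 + d\<^sup>2))\<^sup>2 \<le>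
    16 * ((1 + \<bar>real_of_int a\<bar>) powr (-4/3) * (1 + \<bar>real_of_int c\<bar>) powr (-4/3)
          * (1 + \<bar>real_of_int d\<bar>) powr (-4/3))"
proof -
  define N where "N = real_of_int (a\<^sup>2 + c\<^sup>2 + d\<^sup>2)"
  have "c\<^sup>2 \<ge> 1" using assms by (simp add: int_one_le_iff_zero_less)
  hence "a\<^sup>2 + c\<^sup>2 + d\<^sup>2 \<ge> 1" by (smt (verit) zero_le_power2)
  hence N1: "N \<ge> 1" unfolding N_def by linarith
  define r where "r = sqrt N"
  have r: "r \<ge> 1" "r\<^sup>2 = N" using N1 by (auto simp: r_def)
  have "\<bar>real_of_int n\<bar> \<le> r" if "n \<in> {a, c, d}" for n
  proof -
    have "(real_of_int n)\<^sup>2 \<le> N" using that by (auto simp: N_def)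
    thus ?thesis unfolding r_def by (simp add: real_le_rsqrt)
  qed
  hence "1 + \<bar>real_of_int n\<bar> \<le> 2 * r" if "n \<in> {a, c, d}" for n
    using that r(1) by fastforce
  hence *: "(1 + \<bar>real_of_int n\<bar>) powr (-4/3) \<ge> (2 * r) powr (-4/3)" if "n \<in> {a, c, d}" for n
    using that by (intro powr_mono2') auto
  have "(1 / N)\<^sup>2 = 16 * (2 * r) powr (-4)"
    using r by (simp add: powr_minus powr_numeral power_divide divide_simps power_mult_distrib flip: r(2))
  also have "(2 * r) powr (-4) = (2 * r) powr (-4/3) * (2 * r) powr (-4/3) * (2 * r) powr (-4/3)"
    by (simp flip: powr_add)
  also have "16 * \<dots> \<le> 16 * ((1 + \<bar>real_of_int a\<bar>) powr (-4/3) * (1 + \<bar>real_of_int c\<bar>) powr (-4/3)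
          * (1 + \<bar>real_of_int d\<bar>) powr (-4/3))"
    by (intro mult_mono *) auto
  finally show ?thesis by (simp add: N_def)
qed

lemma ex_bound_sum_powr_int:
  "\<exists>Z. \<forall>F. finite F \<longrightarrow> (\<Sum>n\<in>F. (1 + \<bar>real_of_int n\<bar>) powr (-4/3)) \<le> Z"
proof -
  define g where "g n = (1 + real n) powr (-4/3)" for n
  have "summable (\<lambda>n. real (Suc n) powr (-4/3))"
    by (subst summable_Suc_iff[of "\<lambda>n. real n powr (-4/3)"]) (simp add: summable_real_powr_iff)
  hence g: "summable g" unfolding g_def by (simp add: add.commute)
  have "(\<Sum>n\<in>F. g (nat \<bar>n\<bar>)) \<le> 2 * suminf g" if "finite F" for F
    using that by (intro sum_abs_int_le sum_le_suminf[OF g]) (auto simp: g_def)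
  thus ?thesis by (auto simp: g_def intro!: exI[of _ "2 * suminf g"])
qed

section \<open>From kernel terms to powers of the displacement\<close>

text \<open>Summability is recorded along with the bound because \<open>infsum\<close> is 0 by
  convention on families that are not summable, and splitting the kernel needs genuine
  convergence.\<close>

lemma norm_infsum_le_finite_sums:
  fixes f :: "'a \<Rightarrow> complex"
  assumes "\<And>F. finite F \<Longrightarrow> F \<subseteq> A \<Longrightarrow> (\<Sum>x\<in>F. norm (f x)) \<le> B"
  shows "f summable_on A" "norm (infsum f A) \<le> B"
proof -
  have *: "(\<lambda>x. norm (f x)) summable_on A"
    using assms by (intro nonneg_bdd_above_summable_on) (auto simp: bdd_above_def)
  thus "f summable_on A" by (rule abs_summable_summable)
  have "norm (infsum f A) \<le> (\<Sum>\<^sub>\<infinity>x\<in>A. norm (f x))" by (rule norm_infsum_bound[OF *])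
  also have "\<dots> \<le> B" by (rule infsum_le_finite_sums[OF * assms])
  finally show "norm (infsum f A) \<le> B" .
qed

abbreviation matrix_displacement :: "int^2^2 \<Rightarrow> complex \<Rightarrow> complex \<Rightarrow> real" where
  "matrix_displacement \<gamma> \<equiv> displacement (\<gamma>$1$1) (\<gamma>$1$2) (\<gamma>$2$1) (\<gamma>$2$2)"

lemma SL2Z_det: "\<gamma> \<in> SL2Z \<longleftrightarrow> \<gamma>$1$1 * \<gamma>$2$2 - \<gamma>$1$2 * \<gamma>$2$1 = 1"
  by (simp add: SL2Z_def det_2)

lemma matrix2_eq_iff:
  "\<gamma> = \<gamma>' \<longleftrightarrow> \<gamma>$1$1 = \<gamma>'$1$1 \<and> \<gamma>$1$2 = \<gamma>'$1$2 \<and> \<gamma>$2$1 = \<gamma>'$2$1 \<and> \<gamma>$2$2 = \<gamma>'$2$2"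
  for \<gamma> \<gamma>' :: "'a^2^2"
  by (auto simp: vec_eq_iff forall_2)

text \<open>Cancelling \<open>cz + d\<close> turns \<open>bergman_b\<close> into
  \<open>2 * \<i> / X\<close>, and \<open>|X|^2\<close> is the numerator of the displacement.
  Evenness of \<open>k\<close> makes the half exponent exact.\<close>

lemma norm_bergman_term:
  assumes g: "\<gamma> \<in> SL2Z" and y: "Im z > 0" "Im w > 0" and k: "even k"
  shows "norm (of_real ((Im z * Im w) ^ (k div 2)) * bergman_b \<gamma> z (- cnj w) ^ k)
    = (1 / matrix_displacement \<gamma> z w) ^ (k div 2)"
proof -
  define m where "m = k div 2"
  have k: "k = 2 * m" using k by (simp add: m_def)
  define X where "X = of_int (\<gamma>$1$1) * z + of_int (\<gamma>$1$2)
    - cnj w * (of_int (\<gamma>$2$1) * z + of_int (\<gamma>$2$2))"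
  have j: "aut_factor \<gamma> z \<noteq> 0"
  proof
    assume *: "aut_factor \<gamma> z = 0"
    hence "Im (aut_factor \<gamma> z) = 0" "Re (aut_factor \<gamma> z) = 0" by simp_all
    hence "\<gamma>$2$1 = 0" "\<gamma>$2$2 = 0" using y by (auto simp: aut_factor_def)
    thus False using g by (simp add: SL2Z_det)
  qed
  have "moebius_act \<gamma> z * aut_factor \<gamma> z = of_int (\<gamma>$1$1) * z + of_int (\<gamma>$1$2)"
    using j by (simp add: moebius_act_def)
  hence "(- cnj w + moebius_act \<gamma> z) * aut_factor \<gamma> z = X"
    unfolding distrib_right by (simp add: X_def aut_factor_def)
  hence b: "bergman_b \<gamma> z (- cnj w) = 2 * \<i> / X"
    by (simp add: bergman_b_def)
  have "norm (of_real ((Im z * Im w) ^ m) * bergman_b \<gamma> z (- cnj w) ^ k)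
      = (Im z * Im w) ^ m * (2 / norm X) ^ k"
    using y by (simp add: b norm_mult norm_power norm_divide)
  also have "\<dots> = (Im z * Im w * (2 / norm X)\<^sup>2) ^ m"
    by (simp add: k power_mult power_mult_distrib)
  also have "Im z * Im w * (2 / norm X)\<^sup>2 = 1 / matrix_displacement \<gamma> z w"
    by (simp add: displacement_def power_divide X_def mult_ac)
  finally show ?thesis by (simp add: m_def)
qed

text \<open>Two factors \<open>1 / Q\<close> are reserved for summability and the other
  \<open>m - 2\<close> for decay; \<open>exp (2 * s)\<close> is the price of writing the decay with
  exponent \<open>m\<close>.\<close>

lemma power_inverse_split_le:
  fixes Q q s :: real
  assumes "m \<ge> 2" "q > 0" "q \<le> Q" "exp s \<le> Q"
  shows "(1 / Q) ^ m \<le> (1 / q)\<^sup>2 * (exp (2 * s) * exp (- s * real m))"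
proof -
  have Q: "Q > 0" using assms by linarith
  have "(1 / Q) ^ m = (1 / Q)\<^sup>2 * (1 / Q) ^ (m - 2)"
    by (simp only: power_add[symmetric] le_add_diff_inverse[OF assms(1)])
  also have "\<dots> \<le> (1 / q)\<^sup>2 * (exp (- s)) ^ (m - 2)"
  proof (intro mult_mono power_mono)
    show "1 / Q \<le> 1 / q" using assms Q by (simp add: frac_le)
    have "1 / Q \<le> 1 / exp s" using assms Q by (intro divide_left_mono) auto
    thus "1 / Q \<le> exp (- s)" by (simp add: exp_minus inverse_eq_divide)
  qed (use Q in auto)
  also have "(exp (- s)) ^ (m - 2) = exp (real (m - 2) * (- s))" by (rule exp_of_nat_mult[symmetric])
  also have "\<dots> = exp (2 * s) * exp (- s * real m)"
    using assms(1) by (simp add: of_nat_diff algebra_simps flip: exp_add)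
  finally show ?thesis .
qed

section \<open>Sums over translations and over the remaining matrices\<close>

lemma translation_sum_le:
  assumes z: "z \<in> fund_domain" and zw: "norm (z - w) \<le> 1/100" and m: "m \<ge> 2"
    and F: "finite F" "F \<subseteq> {\<gamma> \<in> SL2Z. \<gamma>$2$1 = 0 \<and> \<gamma>$1$2 \<noteq> 0}"
  shows "(\<Sum>\<gamma>\<in>F. (1 / matrix_displacement \<gamma> z w) ^ m)
    \<le> 87 * (Im z * exp (- (2 * real m) / (17 * (Im z)\<^sup>2)))"
proof -
  define y where "y = Im z"
  have y: "y > 0" "y\<^sup>2 \<ge> 3/4" "y \<ge> 4/5" using fund_domain_Im[OF z] by (auto simp: y_def)
  \<comment> \<open>With \<open>k = 2 * m\<close> this gives \<open>s * m = k / (17 * y^2)\<close>.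
    As \<open>17/2\<close> exceeds 6 sufficiently, \<open>exp s\<close> stays below the displacement
    at \<open>|b| = 1\<close>.\<close>
  define s where "s = 2 / (17 * y\<^sup>2)"
  define E where "E = 3 * exp (- s * real m)"
  define h where "h n = (1 / (1 + (real n / (3 * y))\<^sup>2))\<^sup>2" for n
  have s: "0 \<le> s" "s \<le> 8/51" using y by (auto simp: s_def divide_simps)
  have es: "exp s \<le> 1 + 1 / (6 * y\<^sup>2)"
  proof -
    have "exp s \<le> 1 + s + s\<^sup>2" using s by (intro exp_bound) auto
    also have "s\<^sup>2 \<le> s * (8/51)" unfolding power2_eq_square using s by (intro mult_left_mono) auto
    also have "1 + s + s * (8/51) \<le> 1 + 1 / (6 * y\<^sup>2)"
      using y by (simp add: s_def divide_simps)
    finally show ?thesis by simp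
  qed
  have "exp (2 * s) \<le> exp 1" using s by simp
  hence e3: "exp (2 * s) \<le> 3" using exp_le by linarith
  have bound: "(1 / matrix_displacement \<gamma> z w) ^ m \<le> h (nat \<bar>\<gamma>$1$2\<bar>) * E" if "\<gamma> \<in> F" for \<gamma>
  proof -
    have c0: "\<gamma>$2$1 = 0" "\<gamma>$1$2 \<noteq> 0" "\<gamma>$1$1 * \<gamma>$2$2 = 1" using that F by (auto simp: SL2Z_det)
    let ?b = "real_of_int (\<gamma>$1$2)" and ?Q = "matrix_displacement \<gamma> z w"
    have Q: "?Q \<ge> 1 + ?b\<^sup>2 / (6 * y\<^sup>2)"
      using displacement_translation[OF z c0(3) zw, of "\<gamma>$1$2"] c0(1) by (simp add: y_def)
    have "(\<gamma>$1$2)\<^sup>2 \<ge> 1" using c0(2) by (simp add: int_one_le_iff_zero_less)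
    hence "?b\<^sup>2 \<ge> 1" by (metis of_int_1_le_iff of_int_power)
    hence "1 / (6 * y\<^sup>2) \<le> ?b\<^sup>2 / (6 * y\<^sup>2)" by (intro divide_right_mono) auto
    hence 1: "exp s \<le> ?Q" using es Q by linarith
    \<comment> \<open>Weakening 6 to 9 gives the rational scale \<open>3 * y\<close> used in
      \<open>h\<close>.\<close>
    have "?b\<^sup>2 / (9 * y\<^sup>2) \<le> ?b\<^sup>2 / (6 * y\<^sup>2)" using y by (intro divide_left_mono) auto
    hence 2: "1 + (real (nat \<bar>\<gamma>$1$2\<bar>) / (3 * y))\<^sup>2 \<le> ?Q"
      using Q by (simp add: power_divide power_mult_distrib)
    have "(1 / ?Q) ^ m \<le> h (nat \<bar>\<gamma>$1$2\<bar>) * (exp (2 * s) * exp (- s * real m))"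
      unfolding h_def by (rule power_inverse_split_le[OF m _ 2 1]) (simp add: add_pos_nonneg)
    also have "\<dots> \<le> h (nat \<bar>\<gamma>$1$2\<bar>) * E"
      unfolding E_def using e3 by (intro mult_left_mono mult_right_mono) (auto simp: h_def)
    finally show ?thesis .
  qed
  define \<phi> :: "int^2^2 \<Rightarrow> int \<times> int" where "\<phi> \<gamma> = (\<gamma>$1$1, \<gamma>$1$2)" for \<gamma>
  define B where "B = (\<lambda>\<gamma>. \<gamma>$1$2) ` F"
  have ad: "\<gamma>$1$1 = \<gamma>$2$2 \<and> \<gamma>$1$1 \<in> {1, -1} \<and> \<gamma>$2$1 = 0" if "\<gamma> \<in> F" for \<gamma>
  proof -
    have "\<gamma>$1$1 * \<gamma>$2$2 = 1 \<and> \<gamma>$2$1 = 0" using that F by (auto simp: SL2Z_det)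
    thus ?thesis by (auto simp: zmult_eq_1_iff)
  qed
  have inj: "inj_on \<phi> F"
    unfolding inj_on_def \<phi>_def using ad by (auto simp: matrix2_eq_iff)
  have "(\<Sum>\<gamma>\<in>F. (1 / matrix_displacement \<gamma> z w) ^ m) \<le> (\<Sum>\<gamma>\<in>F. h (nat \<bar>\<gamma>$1$2\<bar>) * E)"
    by (intro sum_mono bound)
  also have "\<dots> = (\<Sum>\<gamma>\<in>F. h (nat \<bar>snd (\<phi> \<gamma>)\<bar>)) * E" by (simp add: sum_distrib_right \<phi>_def)
  also have "(\<Sum>\<gamma>\<in>F. h (nat \<bar>snd (\<phi> \<gamma>)\<bar>)) = (\<Sum>p\<in>\<phi> ` F. h (nat \<bar>snd p\<bar>))"
    by (simp add: sum.reindex[OF inj])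
  also have "\<dots> \<le> (\<Sum>p\<in>{1, -1 :: int} \<times> B. h (nat \<bar>snd p\<bar>))"
  proof (rule sum_mono2)
    show "\<phi> ` F \<subseteq> {1, -1} \<times> B" using ad by (fastforce simp: B_def \<phi>_def)
  qed (use F(1) in \<open>auto simp: B_def h_def\<close>)
  also have "\<dots> = (\<Sum>a\<in>{1, -1 :: int}. \<Sum>b\<in>B. h (nat \<bar>b\<bar>))"
    by (subst sum.cartesian_product) (simp add: case_prod_unfold)
  also have "\<dots> = 2 * (\<Sum>b\<in>B. h (nat \<bar>b\<bar>))" by simp
  also have "(\<Sum>b\<in>B. h (nat \<bar>b\<bar>)) \<le> 2 * (1 + 2 * (3 * y))"
  proof (rule sum_abs_int_le)
    show "(\<Sum>n<N. h n) \<le> 1 + 2 * (3 * y)" for N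
      unfolding h_def using y by (intro sum_inverse_squares_scaled_le) auto
  qed (use F in \<open>auto simp: h_def B_def\<close>)
  \<comment> \<open>The constant term 4 is absorbed by \<open>5 * y\<close>, since
    \<open>y \<ge> 4/5\<close>.\<close>
  also have "2 * (2 * (1 + 2 * (3 * y))) \<le> 29 * y" using y by simp
  finally have "(\<Sum>\<gamma>\<in>F. (1 / matrix_displacement \<gamma> z w) ^ m) \<le> 29 * y * E"
    by (simp add: E_def)
  also have "\<dots> = 87 * (y * exp (- (2 * real m) / (17 * y\<^sup>2)))"
    by (simp add: E_def s_def)
  finally show ?thesis by (simp add: y_def)
qed

text \<open>The entry bound supplies a convergent majorant independent of \<open>z\<close> and
  \<open>w\<close>, and the gap supplies the decay, so \<open>K\<close> can be chosen before all
  other data.\<close>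

lemma ex_bound_nontranslation_sum:
  "\<exists>K > 0. \<forall>\<delta> z w m F. 0 < \<delta> \<and> \<delta> < 1 \<and> z \<in> F_region \<delta> \<and> norm (z - w) \<le> \<delta> / 100000 \<and> m \<ge> 2
     \<and> finite F \<and> F \<subseteq> {\<gamma> \<in> SL2Z. \<gamma>$2$1 \<noteq> 0} \<longrightarrow>
     (\<Sum>\<gamma>\<in>F. (1 / matrix_displacement \<gamma> z w) ^ m) \<le> K * exp (- \<delta>\<^sup>2 / 20000 * real m)"
proof -
  define g where "g n = (1 + \<bar>real_of_int n\<bar>) powr (-4/3)" for n
  obtain Z where Z: "\<And>F. finite F \<Longrightarrow> sum g F \<le> Z"
    using ex_bound_sum_powr_int unfolding g_def by blast
  have Z0: "Z \<ge> 0" using Z[of "{}"] by simp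
  have g0: "g n \<ge> 0" for n by (simp add: g_def)
  \<comment> \<open>The factors come from the entry bound (128 squared), the product bound (16) and
    \<open>exp (2 * s) \<le> 3\<close>; adding 1 ensures positivity.\<close>
  define K where "K = 128\<^sup>2 * 16 * 3 * Z ^ 3 + 1"
  have "(\<Sum>\<gamma>\<in>F. (1 / matrix_displacement \<gamma> z w) ^ m) \<le> K * exp (- \<delta>\<^sup>2 / 20000 * real m)"
    if \<delta>: "0 < \<delta>" "\<delta> < 1" and z: "z \<in> F_region \<delta>" and zw: "norm (z - w) \<le> \<delta> / 100000"
      and m: "m \<ge> 2" and F: "finite F" "F \<subseteq> {\<gamma> \<in> SL2Z. \<gamma>$2$1 \<noteq> 0}"
    for \<delta> z w m and F :: "(int^2^2) set"
  proof -
    \<comment> \<open>Half of the gap: \<open>exp s \<le> 1 + 2 * s\<close> for \<open>s\<close> in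
      this range.\<close>
    define s where "s = \<delta>\<^sup>2 / 20000"
    have zD: "z \<in> fund_domain" using z by (simp add: F_region_def)
    have zw': "norm (z - w) \<le> 1/4" using zw \<delta> by linarith
    have "\<delta>\<^sup>2 \<le> 1" using \<delta> by (simp add: power_le_one)
    hence s: "0 \<le> s" "s \<le> 1/2" by (auto simp: s_def)
    have es: "exp s \<le> 1 + \<delta>\<^sup>2 / 10000"
    proof -
      have "exp s \<le> 1 + s + s\<^sup>2" using s by (intro exp_bound) auto
      also have "s\<^sup>2 \<le> s * 1" unfolding power2_eq_square using s by (intro mult_left_mono) auto
      finally show ?thesis by (simp add: s_def)
    qed
    have "exp (2 * s) \<le> exp 1" using s by simp
    hence e3: "exp (2 * s) \<le> 3" using exp_le by linarith
    define E where "E = 128\<^sup>2 * 16 * 3 * exp (- s * real m)"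
    have bound: "(1 / matrix_displacement \<gamma> z w) ^ m
        \<le> (g (\<gamma>$1$1) * g (\<gamma>$2$1) * g (\<gamma>$2$2)) * E" if "\<gamma> \<in> F" for \<gamma>
    proof -
      have det: "\<gamma>$1$1 * \<gamma>$2$2 - \<gamma>$1$2 * \<gamma>$2$1 = 1" and c: "\<gamma>$2$1 \<noteq> 0"
        using that F by (auto simp: SL2Z_det)
      define N where "N = real_of_int ((\<gamma>$1$1)\<^sup>2 + (\<gamma>$2$1)\<^sup>2 + (\<gamma>$2$2)\<^sup>2)"
      have N: "N > 0" unfolding N_def of_int_0_less_iff
        using c by (intro add_pos_nonneg add_nonneg_pos) auto
      have q: "N / 128 \<le> matrix_displacement \<gamma> z w"
        unfolding N_def by (rule displacement_ge_entries[OF det zD zw'])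
      have Q: "exp s \<le> matrix_displacement \<gamma> z w"
        using displacement_gap[OF z \<delta> det c zw] es by linarith
      have "(1 / matrix_displacement \<gamma> z w) ^ m \<le> (1 / (N / 128))\<^sup>2 * (exp (2 * s) * exp (- s * real m))"
        using N by (intro power_inverse_split_le[OF m _ q Q]) auto
      also have "\<dots> = 128\<^sup>2 * ((1 / N)\<^sup>2 * (exp (2 * s) * exp (- s * real m)))"
        by (simp add: power_divide)
      also have "\<dots> \<le> 128\<^sup>2 * ((16 * (g (\<gamma>$1$1) * g (\<gamma>$2$1) * g (\<gamma>$2$2))) * (3 * exp (- s * real m)))"
        using e3 inverse_norm_le_product[OF c, of "\<gamma>$1$1" "\<gamma>$2$2"] g0 unfolding N_def g_def
        by (intro mult_left_mono mult_mono mult_right_mono) auto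
      finally show ?thesis by (simp add: E_def mult_ac)
    qed
    define \<phi> :: "int^2^2 \<Rightarrow> int \<times> int \<times> int" where "\<phi> \<gamma> = (\<gamma>$1$1, \<gamma>$2$1, \<gamma>$2$2)" for \<gamma>
    \<comment> \<open>The determinant equation recovers the remaining entry because the lower left one is nonzero.\<close>
    have inj: "inj_on \<phi> F"
    proof (rule inj_onI)
      fix \<gamma> \<gamma>' assume *: "\<gamma> \<in> F" "\<gamma>' \<in> F" "\<phi> \<gamma> = \<phi> \<gamma>'"
      hence e: "\<gamma>$1$1 = \<gamma>'$1$1" "\<gamma>$2$1 = \<gamma>'$2$1" "\<gamma>$2$2 = \<gamma>'$2$2" by (auto simp: \<phi>_def)
      have c: "\<gamma>'$2$1 \<noteq> 0" using * F by auto
      have "\<gamma>$1$1 * \<gamma>$2$2 - \<gamma>$1$2 * \<gamma>$2$1 = \<gamma>'$1$1 * \<gamma>'$2$2 - \<gamma>'$1$2 * \<gamma>'$2$1"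
        using * F by (auto simp: SL2Z_det subset_iff)
      hence "\<gamma>$1$2 * \<gamma>'$2$1 = \<gamma>'$1$2 * \<gamma>'$2$1" unfolding e by linarith
      hence "\<gamma>$1$2 = \<gamma>'$1$2" using c by simp
      thus "\<gamma> = \<gamma>'" using e by (simp add: matrix2_eq_iff)
    qed
    define A where "A = (\<lambda>\<gamma>. \<gamma>$1$1) ` F"
    define C where "C = (\<lambda>\<gamma>. \<gamma>$2$1) ` F"
    define D where "D = (\<lambda>\<gamma>. \<gamma>$2$2) ` F"
    have fin: "finite A" "finite C" "finite D" using F by (auto simp: A_def C_def D_def)
    let ?G = "\<lambda>p. g (fst p) * g (fst (snd p)) * g (snd (snd p))"
    have "(\<Sum>\<gamma>\<in>F. (1 / matrix_displacement \<gamma> z w) ^ m)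
        \<le> (\<Sum>\<gamma>\<in>F. (g (\<gamma>$1$1) * g (\<gamma>$2$1) * g (\<gamma>$2$2)) * E)"
      by (intro sum_mono bound)
    also have "\<dots> = (\<Sum>\<gamma>\<in>F. ?G (\<phi> \<gamma>)) * E" by (simp add: sum_distrib_right \<phi>_def)
    also have "\<dots> \<le> Z ^ 3 * E"
    proof (rule mult_right_mono)
      have "(\<Sum>\<gamma>\<in>F. ?G (\<phi> \<gamma>)) = sum ?G (\<phi> ` F)" by (simp add: sum.reindex[OF inj])
      also have "\<dots> \<le> sum ?G (A \<times> (C \<times> D))"
        using fin by (intro sum_mono2) (auto simp: A_def C_def D_def \<phi>_def g0)
      also have "\<dots> = (\<Sum>a\<in>A. \<Sum>c\<in>C. \<Sum>d\<in>D. g a * g c * g d)"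
        by (simp add: sum.cartesian_product case_prod_unfold)
      also have "\<dots> = sum g A * sum g C * sum g D"
        by (simp flip: sum_distrib_left sum_distrib_right)
      also have "\<dots> \<le> Z * Z * Z"
        using fin Z Z0 g0 by (intro mult_mono) (auto intro!: sum_nonneg mult_nonneg_nonneg)
      finally show "(\<Sum>\<gamma>\<in>F. ?G (\<phi> \<gamma>)) \<le> Z ^ 3" by (simp add: power3_eq_cube)
    qed (simp add: E_def)
    also have "\<dots> \<le> K * exp (- s * real m)" by (simp add: E_def K_def algebra_simps)
    finally show ?thesis by (simp add: s_def)
  qed
  moreover have "K > 0" using Z0 by (auto simp: K_def intro!: add_nonneg_pos)
  ultimately show ?thesis by blast
qed

section \<open>Splitting of the kernel and assembly of the estimates\<close>

theorem theorem3p3: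
  "\<exists>c\<^sub>0 > 0. \<exists>C > 0. \<forall>k::nat. even k \<and> k \<ge> 4 \<longrightarrow>
     (\<forall>\<delta>::real. 0 < \<delta> \<and> \<delta> < 1 \<longrightarrow>
       (\<forall>z \<in> F_region \<delta>. \<forall>w \<in> upper_half_plane. norm (z - w) \<le> c\<^sub>0 * \<delta> \<longrightarrow>
          norm (R_kernel k z w
                - 2 * (2 * \<i> * of_real (sqrt (Im z * Im w)) / (z - cnj w)) ^ k)
          \<le> C * (exp (- c\<^sub>0 * \<delta>\<^sup>2 * real k) + Im z * exp (- real k / (17 * (Im z)\<^sup>2)))))"
proof -
  obtain K where K: "K > 0" and gap: "\<And>\<delta> z w m F. 0 < \<delta> \<Longrightarrow> \<delta> < 1 \<Longrightarrow> z \<in> F_region \<delta> \<Longrightarrow>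
     norm (z - w) \<le> \<delta> / 100000 \<Longrightarrow> m \<ge> 2 \<Longrightarrow> finite F \<Longrightarrow> F \<subseteq> {\<gamma> \<in> SL2Z. \<gamma>$2$1 \<noteq> 0} \<Longrightarrow>
     (\<Sum>\<gamma>\<in>F. (1 / matrix_displacement \<gamma> z w) ^ m) \<le> K * exp (- \<delta>\<^sup>2 / 20000 * real m)"
    using ex_bound_nontranslation_sum by blast
  define S0 S1 S2 where "S0 = {mat 1, - mat 1 :: int^2^2}"
    and "S1 = {\<gamma> \<in> SL2Z. \<gamma>$2$1 = 0 \<and> \<gamma>$1$2 \<noteq> 0}" and "S2 = {\<gamma> \<in> SL2Z. \<gamma>$2$1 \<noteq> 0}"
  \<comment> \<open>When \<open>b = c = 0\<close>, the determinant leaves \<open>a = d\<close> equal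
    to 1 or -1, which is exactly \<open>S0\<close>.\<close>
  have S: "SL2Z = S0 \<union> (S1 \<union> S2)" "S0 \<inter> (S1 \<union> S2) = {}" "S1 \<inter> S2 = {}"
    by (auto simp: S0_def S1_def S2_def SL2Z_det matrix2_eq_iff mat_def zmult_eq_1_iff)
  have "norm (R_kernel k z w - 2 * (2 * \<i> * of_real (sqrt (Im z * Im w)) / (z - cnj w)) ^ k)
      \<le> (K + 87) * (exp (- (1 / 100000) * \<delta>\<^sup>2 * real k) + Im z * exp (- real k / (17 * (Im z)\<^sup>2)))"
    if k: "even k" "k \<ge> 4" and \<delta>: "0 < \<delta>" "\<delta> < 1" and z: "z \<in> F_region \<delta>"
      and w: "w \<in> upper_half_plane" and zw: "norm (z - w) \<le> 1 / 100000 * \<delta>" for k \<delta> z w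
  proof -
    define m where "m = k div 2"
    have m: "k = 2 * m" "m \<ge> 2" using k by (auto simp: m_def)
    have zD: "z \<in> fund_domain" using z by (simp add: F_region_def)
    have y: "Im z > 0" "Im w > 0" using fund_domain_Im(1)[OF zD] w by (auto simp: upper_half_plane_def)
    define f where "f \<gamma> = of_real ((Im z * Im w) ^ (k div 2)) * bergman_b \<gamma> z (- cnj w) ^ k" for \<gamma>
    define M where "M = (2 * \<i> * of_real (sqrt (Im z * Im w)) / (z - cnj w)) ^ k"
    have nf: "norm (f \<gamma>) = (1 / matrix_displacement \<gamma> z w) ^ m" if "\<gamma> \<in> SL2Z" for \<gamma>
      unfolding f_def m_def by (rule norm_bergman_term[OF that y k(1)])
    have "(\<Sum>\<gamma>\<in>F. norm (f \<gamma>)) \<le> 87 * (Im z * exp (- (2 * real m) / (17 * (Im z)\<^sup>2)))"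
      if "finite F" "F \<subseteq> S1" for F
    proof -
      have "(\<Sum>\<gamma>\<in>F. norm (f \<gamma>)) = (\<Sum>\<gamma>\<in>F. (1 / matrix_displacement \<gamma> z w) ^ m)"
        using that by (intro sum.cong nf) (auto simp: S1_def)
      thus ?thesis using translation_sum_le[OF zD _ m(2) that(1)] that(2) zw \<delta> by (simp add: S1_def)
    qed
    note s1 = norm_infsum_le_finite_sums[of S1 f, OF this]
    have "(\<Sum>\<gamma>\<in>F. norm (f \<gamma>)) \<le> K * exp (- \<delta>\<^sup>2 / 20000 * real m)"
      if "finite F" "F \<subseteq> S2" for F
    proof -
      have "(\<Sum>\<gamma>\<in>F. norm (f \<gamma>)) = (\<Sum>\<gamma>\<in>F. (1 / matrix_displacement \<gamma> z w) ^ m)"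
        using that by (intro sum.cong nf) (auto simp: S2_def)
      thus ?thesis using gap[OF \<delta> z _ m(2) that(1)] that(2) zw by (simp add: S2_def)
    qed
    note s2 = norm_infsum_le_finite_sums[of S2 f, OF this]
    \<comment> \<open>The two matrices give opposite values of \<open>bergman_b\<close>, equal after
      the even power; hence the factor 2 in the main term.\<close>
    have "f \<gamma> = M" if "\<gamma> \<in> S0" for \<gamma>
    proof -
      have "bergman_b \<gamma> z (- cnj w) \<in> {2 * \<i> / (z - cnj w), - (2 * \<i> / (z - cnj w))}"
        using that by (auto simp: S0_def bergman_b_def moebius_act_def aut_factor_def mat_def
          minus_divide_right)
      hence "bergman_b \<gamma> z (- cnj w) ^ k = (2 * \<i> / (z - cnj w)) ^ k"
        using k(1) by auto
      moreover have "sqrt (Im z * Im w) ^ k = (Im z * Im w) ^ m"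
        using y by (simp add: m power_mult)
      hence "(of_real (sqrt (Im z * Im w)) :: complex) ^ k = of_real ((Im z * Im w) ^ m)"
        by (metis of_real_power)
      moreover have "M = of_real (sqrt (Im z * Im w)) ^ k * (2 * \<i> / (z - cnj w)) ^ k"
        by (simp add: M_def power_mult_distrib power_divide)
      ultimately show ?thesis by (simp add: f_def m_def)
    qed
    moreover have "(mat 1 :: int^2^2) \<noteq> - mat 1" by (simp add: matrix2_eq_iff mat_def)
    ultimately have s0: "sum f S0 = 2 * M" by (simp add: S0_def)
    have "R_kernel k z w = infsum f SL2Z"
      unfolding R_kernel_def f_def by (rule infsum_cmult_right'[symmetric])
    also have "\<dots> = infsum f S0 + infsum f (S1 \<union> S2)"
      unfolding S(1) using s1(1) s2(1) S
      by (intro infsum_Un_disjoint summable_on_Un_disjoint) (auto simp: S0_def)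
    also have "infsum f (S1 \<union> S2) = infsum f S1 + infsum f S2"
      using s1(1) s2(1) S by (intro infsum_Un_disjoint)
    also have "infsum f S0 = 2 * M" using s0 by (simp add: S0_def)
    finally have "norm (R_kernel k z w - 2 * M) \<le> norm (infsum f S1) + norm (infsum f S2)"
      by (simp add: norm_triangle_ineq)
    also have "\<dots> \<le> 87 * (Im z * exp (- real k / (17 * (Im z)\<^sup>2)))
        + K * exp (- (1 / 100000) * \<delta>\<^sup>2 * real k)"
    proof (intro add_mono)
      show "norm (infsum f S1) \<le> 87 * (Im z * exp (- real k / (17 * (Im z)\<^sup>2)))"
        using s1(2) by (simp add: m)
      \<comment> \<open>In terms of \<open>k\<close> the decay rate is
        \<open>\<delta>^2 / 40000\<close>, relaxed here so that 1/100000 serves both as the radius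
        constant and as the exponent.\<close>
      have "K * exp (- \<delta>\<^sup>2 / 20000 * real m) \<le> K * exp (- (1 / 100000) * \<delta>\<^sup>2 * real k)"
        using K by (simp add: m mult_right_mono)
      thus "norm (infsum f S2) \<le> K * exp (- (1 / 100000) * \<delta>\<^sup>2 * real k)" using s2(2) by linarith
    qed
    also have "\<dots> \<le> (K + 87) * (exp (- (1 / 100000) * \<delta>\<^sup>2 * real k) + Im z * exp (- real k / (17 * (Im z)\<^sup>2)))"
      using K y by (simp add: algebra_simps add_nonneg_nonneg)
    finally show ?thesis by (simp add: M_def)
  qed
  thus ?thesis using K by (intro exI[of _ "1/100000"] exI[of _ "K + 87"] conjI) auto
qed

end
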